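(* There is an absolute constant $C$ such that the following holds. Let $d\ge1$, $p\ge2$, and let $\hat{\mathbf U}$ be a tensor train with cores $\hat{\mathbf U}^{(k)}\in\mathbb R^{r_{k-1}\times n_k\times r_k}$, $1\le k\le p$, where $r_0=1$ and $r_1,\dots,r_p\ge1$. Let $\mathbf T$ be one of the two structured tensor trains $\mathcal L\boldsymbol\Psi(x_l)$ or $\nabla\boldsymbol\Psi(x_l)$ with mode sizes $n_1,\dots,n_p$ and TT ranks $s_0=1,s_1,\dots,s_p$ described in the context, given by its cores. Consider the contraction $\mathbf T\cdot\hat{\mathbf U}\in\mathbb R^{s_p\times r_p}$, $$(\mathbf T\cdot\hat{\mathbf U})_{u,v}=\sum_{u_1,\dots,u_p}\mathbf T_{u_1,\dots,u_p;u}\,\hat{\mathbf U}_{u_1,\dots,u_p;v},$$ computed by the following algorithm: set $v=\sum_{u_1}\mathbf T^{(1)}_{:,u_1,:}\otimes\hat{\mathbf U}^{(1)}_{:,u_1,:}$; for $k=2,\dots,p$ replace $$v\leftarrow v\Big[\sum_{u_k}\mathbf T^{(k)}_{:,u_k,:}\otimes\hat{\mathbf U}^{(k)}_{:,u_k,:}\Big];$$ finally reshape the row vector $v$ to shape $s_p\times r_p$. Here $\otimes$ is the Kronecker product of matrices. Then, making use of the sparsity pattern of the cores of $\mathbf T$, the algorithm can be carried out with at most $C\sum_{k=1}^p n_k\,d\,r_{k-1}r_k$ arithmetic operations; i.e. its cost is $\mathcal O\big(\sum_{k=1}^p n_k d\,r_{k-1}r_k\big)$.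
   Context: A tensor train of order $p$ with cores $\mathbf T^{(k)}\in\mathbb R^{s_{k-1}\times n_k\times s_k}$, $s_0=1$, and last rank $s_p\ge1$ (possibly $>1$) encodes one order-$p$ tensor for each $u\in\{1,\dots,s_p\}$: $$\mathbf T_{u_1,\dots,u_p;u}=\mathbf T^{(1)}_{:,u_1,:}\,\mathbf T^{(2)}_{:,u_2,:}\cdots\mathbf T^{(p)}_{:,u_p,u},$$ a product of matrices $\mathbf T^{(k)}_{:,u_k,:}\in\mathbb R^{s_{k-1}\times s_k}$. The Kronecker product of $A\in\mathbb R^{m\times n}$ and $B\in\mathbb R^{r\times q}$ is the $mr\times nq$ block matrix with blocks $A_{ij}B$. A core is displayed as the $s_{k-1}\times s_k$ matrix $[\![\mathbf T^{(k)}]\!]$ with vector entries $\mathbf T^{(k)}_{s,:,t}\in\mathbb R^{n_k}$. The two structured tensor trains are the following. Basis functions: $\psi_k=(\psi_{k,1},\dots,\psi_{k,n_k})^T$ are vectors of $C^2$ functions on $\mathbb X\subset\mathbb R^d$, $\mathcal L\phi=\frac12 a:\nabla^2\phi+b\cdot\nabla\phi$ (applied componentwise to $\psi_k$) is the second-order differential operator with drift $b$ and $a=\sigma\sigma^T$, $\sigma(x)\in\mathbb R^{d\times d}$ having columns $\sigma_{:,i}(x)$; all entries below are evaluated at a data point $x_l\in\mathbb X$, and $\delta_{k,i}=\nabla\psi_k\,\sigma_{:,i}\in\mathbb R^{n_k}$. (1) $\mathcal L\boldsymbol\Psi(x_l)$: ranks $s_1=\cdots=s_{p-1}=d+2$,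 $s_p=1$. First core: $[\psi_1\ \ \mathcal L\psi_1\ \ \delta_{1,1}\ \cdots\ \delta_{1,d}]$. Core $k$ for $2\le k\le p-1$: the $(d+2)\times(d+2)$ matrix with first row $[\psi_k\ \ \mathcal L\psi_k\ \ \delta_{k,1}\cdots\delta_{k,d}]$, all diagonal entries $\psi_k$, entry $\delta_{k,i}$ in row $i+2$ of column $2$ ($i=1,\dots,d$), and zero elsewhere. Last core: the column $[\mathcal L\psi_p\ \ \psi_p\ \ \delta_{p,1}\cdots\delta_{p,d}]^T$. (2) $\nabla\boldsymbol\Psi(x_l)$: ranks $s_1=\cdots=s_{p-1}=d+1$, $s_p=d$. First core: $[\psi_1\ \ \frac{\partial\psi_1}{\partial x^1}\cdots\frac{\partial\psi_1}{\partial x^d}]$. Core $k$ for $2\le k\le p-1$: the $(d+1)\times(d+1)$ matrix with first row $[\psi_k\ \ \frac{\partial\psi_k}{\partial x^1}\cdots\frac{\partial\psi_k}{\partial x^d}]$, all diagonal entries $\psi_k$, and zero elsewhere. Core $p$: the $(d+1)\times d$ matrix with first row $[\frac{\partial\psi_p}{\partial x^1}\cdots\frac{\partial\psi_p}{\partial x^d}]$ and, below it, the $d\times d$ diagonal matrix with all diagonal entries $\psi_p$. The cost counts scalar additions and multiplications; the core entries of $\mathbf T$ and $\hat{\mathbf U}$ are given. *)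

theory Defs
  imports "HOL-Analysis.Abstract_Euclidean_Space" "HOL-Analysis.Derivative" "Jordan_Normal_Form.Matrix"
begin

text \<open>
  Points of \<open>\<real>\<^sup>d\<close> are the elements of \<open>topspace (Euclidean_space d)\<close>, because the dimension is
  quantified inside the statement. Cores are numbered \<open>1, \<dots>, p\<close> and \<open>s 0, \<dots>, s p\<close> are the ranks;
  all other indices (coordinates, modes, rows, columns, basis functions) count from 0.
\<close>

section \<open>Tensor trains and their contraction\<close>

text \<open>
  The matrix \<open>T k u\<close> is the slice of core \<open>k\<close> at mode index \<open>u\<close>, so the core entry with rank
  indices \<open>i\<close>, \<open>j\<close> and mode index \<open>u\<close> is \<open>T k u $$ (i, j)\<close>.
\<close>

type_synonym tensor_train = "nat \<Rightarrow> nat \<Rightarrow> real mat"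

definition tensor_train :: "nat \<Rightarrow> (nat \<Rightarrow> nat) \<Rightarrow> (nat \<Rightarrow> nat) \<Rightarrow> tensor_train \<Rightarrow> bool" where
  "tensor_train p n s T \<longleftrightarrow>
     s 0 = 1 \<and> (\<forall>k\<in>{1..p}. \<forall>u<n k. T k u \<in> carrier_mat (s (k - 1)) (s k))"

primrec tt_product :: "tensor_train \<Rightarrow> (nat \<Rightarrow> nat) \<Rightarrow> nat \<Rightarrow> real mat" where
  "tt_product T us 0 = 1\<^sub>m 1"
| "tt_product T us (Suc k) = tt_product T us k * T (Suc k) (us (Suc k))"

definition tt_entry :: "tensor_train \<Rightarrow> nat \<Rightarrow> (nat \<Rightarrow> nat) \<Rightarrow> nat \<Rightarrow> real" where
  "tt_entry T p us u = tt_product T us p $$ (0, u)"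

definition contraction ::
  "nat \<Rightarrow> (nat \<Rightarrow> nat) \<Rightarrow> (nat \<Rightarrow> nat) \<Rightarrow> (nat \<Rightarrow> nat) \<Rightarrow> tensor_train \<Rightarrow> tensor_train \<Rightarrow> real mat" where
  "contraction p n s r T U = mat (s p) (r p) (\<lambda>(u, v).
     \<Sum>us \<in> (\<Pi>\<^sub>E k\<in>{1..p}. {..<n k}). tt_entry T p us u * tt_entry U p us v)"

definition kronecker :: "real mat \<Rightarrow> real mat \<Rightarrow> real mat" where
  "kronecker A B = mat (dim_row A * dim_row B) (dim_col A * dim_col B)
     (\<lambda>(i, j). A $$ (i div dim_row B, j div dim_col B) * B $$ (i mod dim_row B, j mod dim_col B))"

text \<open>The bracketed matrix of step \<open>k\<close>, i.e. the sum of Kronecker products over the mode index.\<close>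

definition bracket ::
  "(nat \<Rightarrow> nat) \<Rightarrow> (nat \<Rightarrow> nat) \<Rightarrow> (nat \<Rightarrow> nat) \<Rightarrow> tensor_train \<Rightarrow> tensor_train \<Rightarrow> nat \<Rightarrow> real mat" where
  "bracket n s r T U k = mat (s (k - 1) * r (k - 1)) (s k * r k)
     (\<lambda>(i, j). \<Sum>u<n k. kronecker (T k u) (U k u) $$ (i, j))"

text \<open>
  Row-major reshape of a \<open>1 \<times> (m * q)\<close> matrix, which is compatible with the index order of the
  Kronecker product.
\<close>

definition reshape :: "nat \<Rightarrow> nat \<Rightarrow> real mat \<Rightarrow> real mat" where
  "reshape m q w = mat m q (\<lambda>(u, v). w $$ (0, u * q + v))"

section \<open>The structured tensor trains\<close>

definition partial :: "nat \<Rightarrow> ((nat \<Rightarrow> real) \<Rightarrow> real) \<Rightarrow> (nat \<Rightarrow> real) \<Rightarrow> real" where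
  "partial i f x = deriv (\<lambda>t. f (x(i := t))) (x i)"

text \<open>\<open>m\<close> times continuously differentiable on an open set \<open>W\<close> of \<open>\<real>\<^sup>d\<close>.\<close>

primrec Ck_open :: "nat \<Rightarrow> (nat \<Rightarrow> real) set \<Rightarrow> nat \<Rightarrow> ((nat \<Rightarrow> real) \<Rightarrow> real) \<Rightarrow> bool" where
  "Ck_open d W 0 f \<longleftrightarrow> continuous_map (subtopology (Euclidean_space d) W) euclideanreal f"
| "Ck_open d W (Suc m) f \<longleftrightarrow>
     continuous_map (subtopology (Euclidean_space d) W) euclideanreal f \<and>
     (\<forall>i<d. (\<forall>x\<in>W. (\<lambda>t. f (x(i := t))) differentiable at (x i)) \<and> Ck_open d W m (partial i f))"

text \<open>
  The set \<open>X\<close> need not be open; derivatives at its points are those of the given function, which is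
  twice continuously differentiable on a neighbourhood of \<open>X\<close>. For open \<open>X\<close> this is the usual notion.
\<close>

definition C2_on :: "nat \<Rightarrow> (nat \<Rightarrow> real) set \<Rightarrow> ((nat \<Rightarrow> real) \<Rightarrow> real) \<Rightarrow> bool" where
  "C2_on d X f \<longleftrightarrow> (\<exists>W. openin (Euclidean_space d) W \<and> X \<subseteq> W \<and> Ck_open d W 2 f)"

definition diff_op ::
  "nat \<Rightarrow> ((nat \<Rightarrow> real) \<Rightarrow> real vec) \<Rightarrow> ((nat \<Rightarrow> real) \<Rightarrow> real mat) \<Rightarrow>
   ((nat \<Rightarrow> real) \<Rightarrow> real) \<Rightarrow> (nat \<Rightarrow> real) \<Rightarrow> real" where
  "diff_op d b \<sigma> \<phi> x =
     1 / 2 * (\<Sum>i<d. \<Sum>j<d. (\<sigma> x * (\<sigma> x)\<^sup>T) $$ (i, j) * partial i (partial j \<phi>) x)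
     + (\<Sum>i<d. b x $ i * partial i \<phi> x)"

definition sigma_derivative ::
  "nat \<Rightarrow> ((nat \<Rightarrow> real) \<Rightarrow> real mat) \<Rightarrow> ((nat \<Rightarrow> real) \<Rightarrow> real) \<Rightarrow> nat \<Rightarrow> (nat \<Rightarrow> real) \<Rightarrow> real" where
  "sigma_derivative d \<sigma> \<phi> i x = (\<Sum>j<d. partial j \<phi> x * \<sigma> x $$ (j, i))"

text \<open>In the next two definitions \<open>\<psi> k u\<close> is the \<open>u\<close>-th basis function of mode \<open>k\<close>.\<close>

definition generator_train ::
  "nat \<Rightarrow> nat \<Rightarrow> (nat \<Rightarrow> nat \<Rightarrow> (nat \<Rightarrow> real) \<Rightarrow> real) \<Rightarrow> ((nat \<Rightarrow> real) \<Rightarrow> real vec) \<Rightarrow>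
   ((nat \<Rightarrow> real) \<Rightarrow> real mat) \<Rightarrow> (nat \<Rightarrow> real) \<Rightarrow> tensor_train" where
  "generator_train d p \<psi> b \<sigma> x k u =
    (let f = \<psi> k u x;
         Lf = diff_op d b \<sigma> (\<psi> k u) x;
         \<delta> = (\<lambda>i. sigma_derivative d \<sigma> (\<psi> k u) i x);
         first_row = (\<lambda>t. if t = 0 then f else if t = 1 then Lf else \<delta> (t - 2))
     in if k = 1 then mat 1 (d + 2) (\<lambda>(s, t). first_row t)
        else if k < p then mat (d + 2) (d + 2)
          (\<lambda>(s, t). if s = 0 then first_row t
                    else if s = t then f
                    else if t = 1 then \<delta> (s - 2)
                    else 0)
        else mat (d + 2) 1 (\<lambda>(s, t). if s = 0 then Lf else if s = 1 then f else \<delta> (s - 2)))"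

definition gradient_train ::
  "nat \<Rightarrow> nat \<Rightarrow> (nat \<Rightarrow> nat \<Rightarrow> (nat \<Rightarrow> real) \<Rightarrow> real) \<Rightarrow> (nat \<Rightarrow> real) \<Rightarrow> tensor_train" where
  "gradient_train d p \<psi> x k u =
    (let f = \<psi> k u x;
         Df = (\<lambda>i. partial i (\<psi> k u) x);
         first_row = (\<lambda>t. if t = 0 then f else Df (t - 1))
     in if k = 1 then mat 1 (d + 1) (\<lambda>(s, t). first_row t)
        else if k < p then mat (d + 1) (d + 1)
          (\<lambda>(s, t). if s = 0 then first_row t else if s = t then f else 0)
        else mat (d + 1) d (\<lambda>(s, t). if s = 0 then Df t else if s = t + 1 then f else 0))"

datatype train_kind = Generator | Gradient

fun structured_rank :: "train_kind \<Rightarrow> nat \<Rightarrow> nat \<Rightarrow> nat \<Rightarrow> nat" where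
  "structured_rank Generator d p k = (if k = 0 \<or> k = p then 1 else d + 2)"
| "structured_rank Gradient d p k = (if k = 0 then 1 else if k = p then d else d + 1)"

fun structured_train ::
  "train_kind \<Rightarrow> nat \<Rightarrow> nat \<Rightarrow> (nat \<Rightarrow> nat \<Rightarrow> (nat \<Rightarrow> real) \<Rightarrow> real) \<Rightarrow> ((nat \<Rightarrow> real) \<Rightarrow> real vec) \<Rightarrow>
   ((nat \<Rightarrow> real) \<Rightarrow> real mat) \<Rightarrow> (nat \<Rightarrow> real) \<Rightarrow> tensor_train" where
  "structured_train Generator d p \<psi> b \<sigma> x = generator_train d p \<psi> b \<sigma> x"
| "structured_train Gradient d p \<psi> b \<sigma> x = gradient_train d p \<psi> x"

section \<open>Operation counts\<close>

text \<open>
  Costs are measured on straight-line programs: a list of scalar additions and multiplications, each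
  of which stores its result in the next register. The cost of a program is its length. Operands are
  given inputs, earlier registers, or a structural zero; reading them is free, and there are no other
  constants. A program is fixed before its inputs, so it can exploit the positions of the zeros in
  the cores but not the values of the entries.
\<close>

datatype 'i operand = Zero | In 'i | Reg nat

datatype 'i instruction = Add "'i operand" "'i operand" | Mult "'i operand" "'i operand"

fun operand_value :: "('i \<Rightarrow> real) \<Rightarrow> real list \<Rightarrow> 'i operand \<Rightarrow> real" where
  "operand_value env regs Zero = 0"
| "operand_value env regs (In i) = env i"
| "operand_value env regs (Reg m) = (if m < length regs then regs ! m else 0)"

fun instruction_value :: "('i \<Rightarrow> real) \<Rightarrow> real list \<Rightarrow> 'i instruction \<Rightarrow> real" where
  "instruction_value env regs (Add a b) = operand_value env regs a + operand_value env regs b"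
| "instruction_value env regs (Mult a b) = operand_value env regs a * operand_value env regs b"

definition run_program :: "('i \<Rightarrow> real) \<Rightarrow> 'i instruction list \<Rightarrow> real list" where
  "run_program env P = foldl (\<lambda>regs c. regs @ [instruction_value env regs c]) [] P"

text \<open>
  One stage of the algorithm carries out one step. Its inputs are the entries of the two cores and of
  the current row vector; \<open>bracket_at\<close> and \<open>result_at\<close> tell where the entries of the bracketed matrix
  and of the new row vector are found after the run. In \<open>T_entry i u j\<close> and \<open>U_entry i u j\<close> the mode
  index is in the middle.
\<close>

datatype stage_input = T_entry nat nat nat | U_entry nat nat nat | V_entry nat

record stage =
  instructions :: "stage_input instruction list"
  bracket_at :: "nat \<Rightarrow> nat \<Rightarrow> stage_input operand"
  result_at :: "nat \<Rightarrow> stage_input operand"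

fun stage_env ::
  "(nat \<Rightarrow> real mat) \<Rightarrow> (nat \<Rightarrow> real mat) \<Rightarrow> real mat \<Rightarrow> stage_input \<Rightarrow> real" where
  "stage_env A B w (T_entry i u j) = A u $$ (i, j)"
| "stage_env A B w (U_entry i u j) = B u $$ (i, j)"
| "stage_env A B w (V_entry j) = w $$ (0, j)"

definition stage_value ::
  "stage \<Rightarrow> (nat \<Rightarrow> real mat) \<Rightarrow> (nat \<Rightarrow> real mat) \<Rightarrow> real mat \<Rightarrow> stage_input operand \<Rightarrow> real" where
  "stage_value S A B w =
     operand_value (stage_env A B w) (run_program (stage_env A B w) (instructions S))"

definition stage_bracket ::
  "nat \<Rightarrow> nat \<Rightarrow> stage \<Rightarrow> (nat \<Rightarrow> real mat) \<Rightarrow> (nat \<Rightarrow> real mat) \<Rightarrow> real mat \<Rightarrow> real mat" where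
  "stage_bracket m q S A B w = mat m q (\<lambda>(i, j). stage_value S A B w (bracket_at S i j))"

definition stage_result ::
  "nat \<Rightarrow> stage \<Rightarrow> (nat \<Rightarrow> real mat) \<Rightarrow> (nat \<Rightarrow> real mat) \<Rightarrow> real mat \<Rightarrow> real mat" where
  "stage_result q S A B w = mat 1 q (\<lambda>(_, j). stage_value S A B w (result_at S j))"

text \<open>
  Stage 1 initialises the row vector (its incoming vector is irrelevant); a later stage has to
  multiply \<^emph>\<open>every\<close> incoming row vector \<open>w\<close> by the bracketed matrix.
\<close>

definition carries_out_steps ::
  "nat \<Rightarrow> (nat \<Rightarrow> nat) \<Rightarrow> (nat \<Rightarrow> nat) \<Rightarrow> (nat \<Rightarrow> nat) \<Rightarrow> (nat \<Rightarrow> stage) \<Rightarrow>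
   tensor_train \<Rightarrow> tensor_train \<Rightarrow> bool" where
  "carries_out_steps p n s r S T U \<longleftrightarrow>
     (\<forall>k\<in>{1..p}. \<forall>w\<in>carrier_mat 1 (s (k - 1) * r (k - 1)).
        stage_bracket (s (k - 1) * r (k - 1)) (s k * r k) (S k) (T k) (U k) w
          = bracket n s r T U k \<and>
        stage_result (s k * r k) (S k) (T k) (U k) w
          = (if k = 1 then bracket n s r T U k else w * bracket n s r T U k))"

primrec run_stages ::
  "(nat \<Rightarrow> nat) \<Rightarrow> (nat \<Rightarrow> nat) \<Rightarrow> (nat \<Rightarrow> stage) \<Rightarrow> tensor_train \<Rightarrow> tensor_train \<Rightarrow> nat \<Rightarrow> real mat" where
  "run_stages s r S T U 0 = 0\<^sub>m 1 1"
| "run_stages s r S T U (Suc k) =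
     stage_result (s (Suc k) * r (Suc k)) (S (Suc k)) (T (Suc k)) (U (Suc k))
       (run_stages s r S T U k)"

definition operation_count :: "nat \<Rightarrow> (nat \<Rightarrow> stage) \<Rightarrow> nat" where
  "operation_count p S = (\<Sum>k=1..p. length (instructions (S k)))"

end

theory Submission
  imports Defs
begin

text \<open>
  At most \<open>5 (d + 2) \<le> 15 d\<close> entries of a slice of a structured core can be nonzero. Each of them
  contributes one block of \<open>r (k - 1) * r k\<close> entries to the bracketed matrix; an entry costs \<open>n k\<close>
  multiplications and additions to form, and one of each in the product with the row vector. This
  is at most \<open>4 n k\<close> operations per entry, hence the constant 60. That the recursion computes the
  contraction is the mixed-product rule, read entrywise with a Kronecker index \<open>j\<close> split into
  \<open>j div q\<close> and \<open>j mod q\<close>.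
\<close>

section \<open>Straight-line programs\<close>

definition program_value :: "('i \<Rightarrow> real) \<Rightarrow> 'i instruction list \<Rightarrow> 'i operand \<Rightarrow> real" where
  "program_value env P a = operand_value env (run_program env P) a"

text \<open>Reading a register that has not been written yields 0, so an operand may change its
  value when the program grows. Availability excludes this.\<close>

definition available :: "nat \<Rightarrow> 'i operand \<Rightarrow> bool" where
  "available N a \<longleftrightarrow> (\<forall>m. a = Reg m \<longrightarrow> m < N)"

lemma available_simps [simp]:
  "available N Zero" "available N (In i)" "available N (Reg m) \<longleftrightarrow> m < N"
  by (auto simp: available_def)

lemma available_mono: "available M a \<Longrightarrow> M \<le> N \<Longrightarrow> available N a"
  by (auto simp: available_def)

lemma run_program_Nil [simp]: "run_program env [] = []"
  by (simp add: run_program_def)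

lemma run_program_snoc [simp]:
  "run_program env (P @ [c]) = run_program env P @ [instruction_value env (run_program env P) c]"
  by (simp add: run_program_def)

lemma length_run_program [simp]: "length (run_program env P) = length P"
  by (induction P rule: rev_induct) auto

lemma program_value_Zero [simp]: "program_value env P Zero = 0"
  by (simp add: program_value_def)

lemma program_value_In [simp]: "program_value env P (In i) = env i"
  by (simp add: program_value_def)

text \<open>Registers are written once and never overwritten. This is what allows programs to be
  built by appending pieces.\<close>

lemma program_value_append:
  assumes "available (length P) a"
  shows "program_value env (P @ R) a = program_value env P a"
proof (induction R rule: rev_induct)
  case (snoc c R)
  have "program_value env ((P @ R) @ [c]) a = program_value env (P @ R) a"
    using assms unfolding program_value_def run_program_snoc
    by (cases a) (auto simp: nth_append)
  then show ?case
    using snoc by simp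
qed simp

lemma program_value_new_register:
  "program_value env (P @ [c]) (Reg (length P)) = instruction_value env (run_program env P) c"
  by (simp add: program_value_def nth_append)

text \<open>Each term costs one multiplication and one addition, the addition to the initial
  \<open>Zero\<close> included, so the count is exact. \<open>R\<close> and \<open>c\<close> are
  chosen before \<open>env\<close>, because a program must not depend on the input values.\<close>

lemma dot_product_program:
  assumes "\<forall>(a, b)\<in>set xs. available (length P) a \<and> available (length P) b"
  shows "\<exists>R c. length R = 2 * length xs \<and> available (length (P @ R)) c \<and>
    (\<forall>env. program_value env (P @ R) c =
      (\<Sum>(a, b)\<leftarrow>xs. program_value env P a * program_value env P b))"
  using assms
proof (induction xs)
  case Nil
  show ?case
    by (rule exI[of _ "[]"], rule exI[of _ Zero]) simp
next
  case (Cons ab xs)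
  obtain a b where ab: "ab = (a, b)"
    by force
  from Cons obtain R c where R: "length R = 2 * length xs" "available (length (P @ R)) c"
    and val: "\<And>env. program_value env (P @ R) c =
      (\<Sum>(a, b)\<leftarrow>xs. program_value env P a * program_value env P b)"
    by auto
  \<comment> \<open>The product lands in register \<open>length (P @ R)\<close> and the new partial
    sum in the next one, \<open>length ?P1\<close>.\<close>
  let ?P1 = "(P @ R) @ [Mult a b]"
  let ?P2 = "?P1 @ [Add (Reg (length (P @ R))) c]"
  have av: "available (length P) a" "available (length P) b"
    using Cons.prems ab by auto
  have "program_value env ?P2 (Reg (length ?P1)) =
      program_value env P a * program_value env P b + program_value env (P @ R) c" for env
  proof -
    have "program_value env ?P2 (Reg (length ?P1)) =
        program_value env ?P1 (Reg (length (P @ R))) + program_value env ?P1 c"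
      by (subst program_value_new_register) (simp add: program_value_def)
    also have "program_value env ?P1 (Reg (length (P @ R))) =
        program_value env (P @ R) a * program_value env (P @ R) b"
      by (subst program_value_new_register) (simp add: program_value_def)
    also have "program_value env ?P1 c = program_value env (P @ R) c"
      by (rule program_value_append) (rule R)
    finally show ?thesis
      using av by (simp add: program_value_append)
  qed
  then show ?case
    using R(1) val ab
    by (intro exI[of _ "R @ [Mult a b, Add (Reg (length (P @ R))) c]"]
        exI[of _ "Reg (length ?P1)"]) simp
qed

text \<open>The dot products are appended one after another; all factors come from \<open>P\<close>,
  and results already stored survive. Availability of the results lets a second family of dot
  products read them.\<close>

lemma dot_products_program:
  assumes "finite J"
    and "\<forall>j\<in>J. \<forall>(a, b)\<in>set (xs j). available (length P) a \<and> available (length P) b"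
  shows "\<exists>R c. length R = 2 * (\<Sum>j\<in>J. length (xs j)) \<and>
    (\<forall>j\<in>J. available (length (P @ R)) (c j) \<and>
      (\<forall>env. program_value env (P @ R) (c j) =
        (\<Sum>(a, b)\<leftarrow>xs j. program_value env P a * program_value env P b)))"
  using assms
proof (induction J rule: finite_induct)
  case empty
  then show ?case by simp
next
  case (insert j J)
  have "\<forall>j\<in>J. \<forall>(a, b)\<in>set (xs j). available (length P) a \<and> available (length P) b"
    using insert.prems by simp
  from insert.IH[OF this] obtain R c where R: "length R = 2 * (\<Sum>j\<in>J. length (xs j))"
    and Rc: "\<forall>j\<in>J. available (length (P @ R)) (c j) \<and>
      (\<forall>env. program_value env (P @ R) (c j) =
        (\<Sum>(a, b)\<leftarrow>xs j. program_value env P a * program_value env P b))"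
    by (elim exE conjE)
  from Rc have c: "\<And>i. i \<in> J \<Longrightarrow> available (length (P @ R)) (c i)"
      "\<And>i env. i \<in> J \<Longrightarrow> program_value env (P @ R) (c i) =
        (\<Sum>(a, b)\<leftarrow>xs i. program_value env P a * program_value env P b)"
    by blast+
  have av: "available (length P) a \<and> available (length P) b" if "(a, b) \<in> set (xs j)" for a b
    using insert.prems that by auto
  then have "\<forall>(a, b)\<in>set (xs j). available (length (P @ R)) a \<and> available (length (P @ R)) b"
    by (fastforce intro: available_mono)
  from dot_product_program[OF this] obtain R' c' where R': "length R' = 2 * length (xs j)"
    "available (length ((P @ R) @ R')) c'"
    "\<And>env. program_value env ((P @ R) @ R') c' =
      (\<Sum>(a, b)\<leftarrow>xs j. program_value env (P @ R) a * program_value env (P @ R) b)"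
    by blast
  have "(\<Sum>(a, b)\<leftarrow>xs j. program_value env (P @ R) a * program_value env (P @ R) b) =
      (\<Sum>(a, b)\<leftarrow>xs j. program_value env P a * program_value env P b)" for env
    using av by (intro arg_cong[where f = sum_list] map_cong) (auto simp: program_value_append)
  then have "\<forall>i\<in>insert j J. available (length (P @ R @ R')) ((c(j := c')) i) \<and>
      (\<forall>env. program_value env (P @ R @ R') ((c(j := c')) i) =
        (\<Sum>(a, b)\<leftarrow>xs i. program_value env P a * program_value env P b))"
    using R' c insert.hyps program_value_append[OF c(1), where R = R']
    by (auto intro: available_mono[OF c(1)])
  moreover have "length (R @ R') = 2 * (\<Sum>j\<in>insert j J. length (xs j))"
    using R R' insert.hyps by simp
  ultimately show ?case
    by blast
qed

section \<open>One step of the algorithm\<close>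

lemma div_less_of_less_mult: "i < m * q \<Longrightarrow> i div q < (m::nat)"
  by (simp add: less_mult_imp_div_less)

lemma mod_less_of_less_mult: "i < m * q \<Longrightarrow> i mod q < (q::nat)"
  by (cases "q = 0") auto

text \<open>A position is determined by its block and its place inside the block, so
  \<open>card Q\<close> blocks of size \<open>q0 * q1\<close> cover everything that is
  counted.\<close>

lemma card_block_support_le:
  assumes "finite Q"
  shows "card {(i, j). i < m0 * q0 \<and> j < m1 * q1 \<and> (i div q0, j div q1) \<in> Q}
    \<le> card Q * (q0 * q1)" (is "card ?I \<le> _")
proof -
  let ?f = "\<lambda>((a, c), (i, j)). (a * q0 + i, c * q1 + j)"
  have "?I \<subseteq> ?f ` (Q \<times> ({..<q0} \<times> {..<q1}))"
  proof clarify
    fix i j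
    assume *: "i < m0 * q0" "j < m1 * q1" "(i div q0, j div q1) \<in> Q"
    show "(i, j) \<in> ?f ` (Q \<times> ({..<q0} \<times> {..<q1}))"
      by (rule image_eqI[of _ _ "((i div q0, j div q1), (i mod q0, j mod q1))"])
        (use * in \<open>auto intro: mod_less_of_less_mult\<close>)
  qed
  then have "card ?I \<le> card (?f ` (Q \<times> ({..<q0} \<times> {..<q1})))"
    using assms by (intro card_mono) auto
  also have "\<dots> \<le> card (Q \<times> ({..<q0} \<times> {..<q1}))"
    using assms by (intro card_image_le) auto
  finally show ?thesis
    by (simp add: card_cartesian_product)
qed

lemma kronecker_index:
  assumes "A \<in> carrier_mat m0 m1" "B \<in> carrier_mat q0 q1" "i < m0 * q0" "j < m1 * q1"
  shows "kronecker A B $$ (i, j) = A $$ (i div q0, j div q1) * B $$ (i mod q0, j mod q1)"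
  using assms by (simp add: kronecker_def)

lemma sum_upt_filter:
  "(\<Sum>i\<leftarrow>filter P [0..<N]. f i) = (\<Sum>i | i < N \<and> P i. f i)"
  by (subst sum_list_distinct_conv_sum_set) (auto intro!: sum.cong)

text \<open>The budget \<open>4 * n * \<dots>\<close> leaves no operation for an empty mode, not even for the product with
  the row vector; hence \<open>Q\<close> has to be empty if \<open>n = 0\<close>.\<close>

lemma sparse_stage:
  assumes Q: "finite Q" and Q0: "n = 0 \<Longrightarrow> Q = {}"
  shows "\<exists>S. length (instructions S) \<le> 4 * n * (card Q * (q0 * q1)) \<and>
    (\<forall>A B w M.
      (\<forall>u<n. A u \<in> carrier_mat m0 m1 \<and> B u \<in> carrier_mat q0 q1 \<and>
        (\<forall>a<m0. \<forall>c<m1. (a, c) \<notin> Q \<longrightarrow> A u $$ (a, c) = 0)) \<longrightarrow>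
      w \<in> carrier_mat 1 (m0 * q0) \<longrightarrow>
      M = mat (m0 * q0) (m1 * q1) (\<lambda>(i, j). \<Sum>u<n. kronecker (A u) (B u) $$ (i, j)) \<longrightarrow>
      stage_bracket (m0 * q0) (m1 * q1) S A B w = M \<and>
      stage_result (m1 * q1) S A B w = (if first \<and> m0 * q0 = 1 then M else w * M))"
proof -
  \<comment> \<open>The positions in blocks over \<open>Q\<close>: only these entries of the
    bracketed matrix are ever formed.\<close>
  define I where "I = {(i, j). i < m0 * q0 \<and> j < m1 * q1 \<and> (i div q0, j div q1) \<in> Q}"
  have "I \<subseteq> {..<m0 * q0} \<times> {..<m1 * q1}"
    by (auto simp: I_def)
  then have finI: "finite I"
    using finite_subset by blast
  have cardI: "card I \<le> card Q * (q0 * q1)"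
    unfolding I_def by (rule card_block_support_le[OF Q])
  \<comment> \<open>The factors of one bracket entry are inputs, so \<open>P\<close> can be built
    from the empty program.\<close>
  define xs where "xs = (\<lambda>(i, j). map (\<lambda>u. (In (T_entry (i div q0) u (j div q1)),
    In (U_entry (i mod q0) u (j mod q1)))) [0..<n])"
  have "\<forall>ij\<in>I. \<forall>(a, b)\<in>set (xs ij).
      available (length ([] :: stage_input instruction list)) a \<and>
      available (length ([] :: stage_input instruction list)) b"
    by (auto simp: xs_def)
  from dot_products_program[OF finI this, unfolded append_Nil] obtain P c
    where P: "length P = 2 * (\<Sum>j\<in>I. length (xs j))"
      and c: "\<And>ij. ij \<in> I \<Longrightarrow> available (length P) (c ij)"
        "\<And>ij env. ij \<in> I \<Longrightarrow> program_value env P (c ij) =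
          (\<Sum>(a, b)\<leftarrow>xs ij. program_value env [] a * program_value env [] b)"
    by blast
  \<comment> \<open>Filtering out the positions off \<open>I\<close> keeps the number of terms,
    totalled over all columns, at \<open>card I\<close>.\<close>
  define ys where "ys = (\<lambda>j. map (\<lambda>i. (In (V_entry i), c (i, j)))
    (filter (\<lambda>i. (i, j) \<in> I) [0..<m0 * q0]))"
  have "\<forall>j\<in>{..<m1 * q1}. \<forall>(a, b)\<in>set (ys j). available (length P) a \<and> available (length P) b"
    using c(1) by (auto simp: ys_def)
  from dot_products_program[OF finite_lessThan this] obtain R e
    where R: "length R = 2 * (\<Sum>j<m1 * q1. length (ys j))"
      and e: "\<And>j env. j < m1 * q1 \<Longrightarrow> program_value env (P @ R) (e j) =
          (\<Sum>(a, b)\<leftarrow>ys j. program_value env P a * program_value env P b)"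
    by blast
  \<comment> \<open>Structural zeros are read as \<open>Zero\<close>, at no cost.\<close>
  define br where "br = (\<lambda>i j. if (i, j) \<in> I then c (i, j) else Zero)"
  \<comment> \<open>An initialising stage whose bracketed matrix has a single row returns that row.
    The instructions \<open>R\<close> stay in the program even then, so one count serves every
    stage.\<close>
  define S where "S = \<lparr>instructions = P @ R, bracket_at = br,
    result_at = (if first \<and> m0 * q0 = 1 then br 0 else e)\<rparr>"
  have "length (ys j) = card {i. (i, j) \<in> I}" for j
  proof -
    have "length (ys j) = card {i. i < m0 * q0 \<and> (i, j) \<in> I}"
      unfolding ys_def using length_filter_conv_card[of "\<lambda>i. (i, j) \<in> I" "[0..<m0 * q0]"]
      by (simp cong: conj_cong)
    also have "{i. i < m0 * q0 \<and> (i, j) \<in> I} = {i. (i, j) \<in> I}"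
      by (auto simp: I_def)
    finally show ?thesis .
  qed
  \<comment> \<open>Counting \<open>I\<close> column by column gives the total length of the lists
    \<open>ys j\<close>.\<close>
  moreover have "(\<Sum>j<m1 * q1. card {i. (i, j) \<in> I}) = card I"
  proof -
    have "(\<Sum>j<m1 * q1. card {i. (i, j) \<in> I}) = card (Sigma {..<m1 * q1} (\<lambda>j. {i. (i, j) \<in> I}))"
      by (rule card_SigmaI[symmetric])
        (auto simp: I_def intro: finite_subset[of _ "{..<m0 * q0}"])
    also have "Sigma {..<m1 * q1} (\<lambda>j. {i. (i, j) \<in> I}) = prod.swap ` I"
      by (force simp: I_def)
    finally show ?thesis
      by (simp add: card_image)
  qed
  ultimately have "length (instructions S) = 2 * (n * card I) + 2 * card I"
    using P R by (simp add: S_def xs_def case_prod_unfold)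
  \<comment> \<open>For \<open>n \<ge> 1\<close> the \<open>2 * card I\<close> operations of the
    row-vector product are at most \<open>2 * (n * card I)\<close>; for \<open>n = 0\<close> the set
    \<open>I\<close> is empty.\<close>
  also have "\<dots> \<le> 4 * (n * card I)"
  proof (cases "n = 0")
    case True
    then show ?thesis
      using Q0 by (simp add: I_def)
  qed simp
  also have "\<dots> \<le> 4 * (n * (card Q * (q0 * q1)))"
    using cardI by simp
  finally have len: "length (instructions S) \<le> 4 * n * (card Q * (q0 * q1))"
    by (simp add: mult.assoc)
  have "stage_bracket (m0 * q0) (m1 * q1) S A B w = M \<and>
      stage_result (m1 * q1) S A B w = (if first \<and> m0 * q0 = 1 then M else w * M)"
    if cores: "\<forall>u<n. A u \<in> carrier_mat m0 m1 \<and> B u \<in> carrier_mat q0 q1 \<and>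
        (\<forall>a<m0. \<forall>c<m1. (a, c) \<notin> Q \<longrightarrow> A u $$ (a, c) = 0)"
      and w: "w \<in> carrier_mat 1 (m0 * q0)"
      and M: "M = mat (m0 * q0) (m1 * q1) (\<lambda>(i, j). \<Sum>u<n. kronecker (A u) (B u) $$ (i, j))"
    for A B w M
  proof -
    let ?env = "stage_env A B w"
    have stage_val: "stage_value S A B w = program_value ?env (P @ R)"
      by (simp add: stage_value_def program_value_def S_def fun_eq_iff)
    have S_sel: "bracket_at S = br" "result_at S = (if first \<and> m0 * q0 = 1 then br 0 else e)"
      by (simp_all add: S_def)
    have M_index: "M $$ (i, j) =
        (\<Sum>u<n. A u $$ (i div q0, j div q1) * B u $$ (i mod q0, j mod q1))"
      if "i < m0 * q0" "j < m1 * q1" for i j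
      using that cores by (auto simp: M intro!: sum.cong kronecker_index)
    \<comment> \<open>Every summand contains the factor \<open>A u $$ (i div q0, j div q1)\<close>,
      a structural zero.\<close>
    have M_zero: "M $$ (i, j) = 0" if "i < m0 * q0" "j < m1 * q1" "(i, j) \<notin> I" for i j
    proof -
      have "(i div q0, j div q1) \<notin> Q"
        using that by (auto simp: I_def)
      then show ?thesis
        using that(1,2) cores by (simp add: M_index div_less_of_less_mult)
    qed
    have c_val: "program_value ?env P (c (i, j)) = M $$ (i, j)" if "(i, j) \<in> I" for i j
    proof -
      have "i < m0 * q0" "j < m1 * q1"
        using that by (auto simp: I_def)
      then show ?thesis
        using c(2)[OF that] M_index
        by (simp add: xs_def o_def interv_sum_list_conv_sum_set_nat atLeast0LessThan)
    qed
    have br_val: "program_value ?env (P @ R) (br i j) = M $$ (i, j)"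
      if "i < m0 * q0" "j < m1 * q1" for i j
      using that M_zero c_val c(1) by (simp add: br_def program_value_append)
    have e_val: "program_value ?env (P @ R) (e j) = (w * M) $$ (0, j)" if j: "j < m1 * q1" for j
    proof -
      have "program_value ?env (P @ R) (e j) =
          (\<Sum>i\<leftarrow>filter (\<lambda>i. (i, j) \<in> I) [0..<m0 * q0]. w $$ (0, i) * program_value ?env P (c (i, j)))"
        using e[OF j] by (simp add: ys_def o_def)
      also have "\<dots> = (\<Sum>i | i < m0 * q0 \<and> (i, j) \<in> I. w $$ (0, i) * M $$ (i, j))"
        unfolding sum_upt_filter using c_val by (intro sum.cong) auto
      also have "\<dots> = (\<Sum>i<m0 * q0. w $$ (0, i) * M $$ (i, j))"
        using M_zero j by (intro sum.mono_neutral_left) auto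
      also have "\<dots> = (w * M) $$ (0, j)"
        using w j unfolding M by (simp add: scalar_prod_def atLeast0LessThan)
      finally show ?thesis .
    qed
    have "stage_bracket (m0 * q0) (m1 * q1) S A B w = M"
      using br_val by (intro eq_matI) (auto simp: stage_bracket_def stage_val S_sel M)
    moreover have "stage_result (m1 * q1) S A B w = (if first \<and> m0 * q0 = 1 then M else w * M)"
    proof (cases "first \<and> m0 * q0 = 1")
      case True
      then show ?thesis
        using br_val by (intro eq_matI) (auto simp: stage_result_def stage_val S_sel M)
    next
      case False
      have "stage_result (m1 * q1) S A B w = w * M"
        using False w e_val by (intro eq_matI) (auto simp: stage_result_def stage_val S_sel M)
      then show ?thesis
        unfolding if_not_P[OF False] .
    qed
    ultimately show ?thesis ..
  qed
  with len show ?thesis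
    by (intro exI[of _ S] conjI[OF len] allI impI)
qed

section \<open>Correctness of the recursion\<close>

text \<open>Row-major numbering of index pairs is a bijection. It turns a sum over a Kronecker index
  into a double sum over two rank indices.\<close>

lemma sum_div_mod:
  "(\<Sum>i<m * q. f (i div q) (i mod q)) = (\<Sum>a<m. \<Sum>c<(q::nat). (f a c :: real))"
proof -
  have "(\<Sum>a<m. \<Sum>c<q. f a c) = (\<Sum>(a, c)\<in>{..<m} \<times> {..<q}. f a c)"
    by (simp add: sum.cartesian_product)
  also have "\<dots> = (\<Sum>i<m * q. f (i div q) (i mod q))"
  proof (rule sum.reindex_bij_witness[of _ "\<lambda>i. (i div q, i mod q)" "\<lambda>(a, c). a * q + c"])
    fix ac
    assume "ac \<in> {..<m} \<times> {..<q}"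
    then obtain a c where ac: "ac = (a, c)" "a < m" "c < q"
      by auto
    then have "a * q + c < Suc a * q"
      by simp
    also have "\<dots> \<le> m * q"
      using ac by (intro mult_le_mono1) simp
    finally show "(case ac of (a, c) \<Rightarrow> a * q + c) \<in> {..<m * q}"
      using ac by simp
  qed (auto simp: div_less_of_less_mult mod_less_of_less_mult)
  finally show ?thesis ..
qed

section \<open>Partial products and partial contractions of tensor trains\<close>

lemma tt_product_cong:
  "(\<And>i. i \<in> {1..k} \<Longrightarrow> us i = vs i) \<Longrightarrow> tt_product T us k = tt_product T vs k"
  by (induction k) auto

lemma tt_product_carrier:
  assumes "tensor_train p n s T" "k \<le> p" "\<And>i. i \<in> {1..k} \<Longrightarrow> us i < n i"
  shows "tt_product T us k \<in> carrier_mat 1 (s k)"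
  using assms(2,3)
proof (induction k)
  case 0
  then show ?case
    using assms(1) by (simp add: tensor_train_def)
next
  case (Suc k)
  have "T (Suc k) (us (Suc k)) \<in> carrier_mat (s k) (s (Suc k))"
    using assms(1) Suc.prems by (force simp: tensor_train_def)
  with Suc show ?case
    by (auto intro!: mult_carrier_mat)
qed

lemma tt_product_Suc_index:
  assumes "tensor_train p n s T" "Suc k \<le> p" "\<And>i. i \<in> {1..Suc k} \<Longrightarrow> us i < n i" "a < s (Suc k)"
  shows "tt_product T us (Suc k) $$ (0, a) =
    (\<Sum>i<s k. tt_product T us k $$ (0, i) * T (Suc k) (us (Suc k)) $$ (i, a))"
proof -
  have "T (Suc k) (us (Suc k)) \<in> carrier_mat (s k) (s (Suc k))"
    using assms by (force simp: tensor_train_def)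
  moreover have "tt_product T us k \<in> carrier_mat 1 (s k)"
    using assms by (intro tt_product_carrier) auto
  ultimately show ?thesis
    using assms(4) by (simp add: scalar_prod_def atLeast0LessThan)
qed

text \<open>Each member of the larger product arises exactly once as \<open>g(x := y)\<close>. Used
  to split off the index of the last mode.\<close>

lemma sum_PiE_insert:
  assumes "x \<notin> S"
  shows "(\<Sum>g\<in>PiE (insert x S) F. f g) = (\<Sum>g\<in>PiE S F. \<Sum>y\<in>F x. f (g(x := y)))"
proof -
  have "(\<Sum>g\<in>PiE (insert x S) F. f g) = (\<Sum>(y, g)\<in>F x \<times> PiE S F. f (g(x := y)))"
    unfolding PiE_insert_eq
    using inj_combinator[OF assms, of F]
    by (subst sum.reindex) (auto simp: case_prod_unfold)
  also have "\<dots> = (\<Sum>y\<in>F x. \<Sum>g\<in>PiE S F. f (g(x := y)))"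
    by (simp add: sum.cartesian_product)
  finally show ?thesis
    by (simp add: sum.swap[of _ "F x"])
qed

text \<open>The loop invariant: the contraction over the first \<open>k\<close> modes with the two
  rank indices left open. At \<open>k = p\<close> it is an entry of
  \<open>contraction\<close>.\<close>

definition joint_sum ::
  "(nat \<Rightarrow> nat) \<Rightarrow> tensor_train \<Rightarrow> tensor_train \<Rightarrow> nat \<Rightarrow> nat \<Rightarrow> nat \<Rightarrow> real" where
  "joint_sum n T U k a c = (\<Sum>us \<in> (\<Pi>\<^sub>E i\<in>{1..k}. {..<n i}).
     tt_product T us k $$ (0, a) * tt_product U us k $$ (0, c))"

lemma joint_sum_0: "joint_sum n T U 0 0 0 = 1"
  by (simp add: joint_sum_def)

text \<open>For fixed rank indices \<open>i\<close> and \<open>l\<close> the summand is a factor in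
  the first \<open>k\<close> mode indices times a factor in the last one, so the sums separate. The
  first gives \<open>joint_sum\<close>, the second the bracket entry whose row is the Kronecker
  index of \<open>(i, l)\<close>.\<close>

lemma joint_sum_Suc:
  assumes T: "tensor_train p n s T" and U: "tensor_train p n r U" and k: "Suc k \<le> p"
    and j: "j < s (Suc k) * r (Suc k)"
  shows "joint_sum n T U (Suc k) (j div r (Suc k)) (j mod r (Suc k)) =
    (\<Sum>i<s k * r k. joint_sum n T U k (i div r k) (i mod r k) * bracket n s r T U (Suc k) $$ (i, j))"
proof -
  let ?a = "j div r (Suc k)" and ?c = "j mod r (Suc k)"
  let ?N = "n (Suc k)" and ?T = "T (Suc k)" and ?U = "U (Suc k)"
  let ?E = "\<Pi>\<^sub>E i\<in>{1..k}. {..<n i}"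
  let ?t = "\<lambda>us. tt_product T us k" and ?u = "\<lambda>us. tt_product U us k"
  have ac: "?a < s (Suc k)" "?c < r (Suc k)"
    using j by (auto intro: div_less_of_less_mult mod_less_of_less_mult)
  have step: "tt_product T (us(Suc k := y)) (Suc k) $$ (0, ?a) *
        tt_product U (us(Suc k := y)) (Suc k) $$ (0, ?c) =
      (\<Sum>i<s k. \<Sum>l<r k. ?t us $$ (0, i) * ?u us $$ (0, l) * (?T y $$ (i, ?a) * ?U y $$ (l, ?c)))"
    if us: "us \<in> ?E" and y: "y < ?N" for us y
  proof -
    have range: "(us(Suc k := y)) i < n i" if "i \<in> {1..Suc k}" for i
      using us y that by (auto simp: PiE_iff le_Suc_eq)
    \<comment> \<open>The first \<open>k\<close> cores do not see the update at
      \<open>Suc k\<close>.\<close>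
    have "?t (us(Suc k := y)) = ?t us" "?u (us(Suc k := y)) = ?u us"
      by (auto intro: tt_product_cong)
    moreover note tt_product_Suc_index[where us = "us(Suc k := y)", OF T k range ac(1)]
      tt_product_Suc_index[where us = "us(Suc k := y)", OF U k range ac(2)]
    ultimately show ?thesis
      by (simp add: sum_product algebra_simps del: tt_product.simps)
  qed
  have bracket_index: "bracket n s r T U (Suc k) $$ (i, j) =
      (\<Sum>y<?N. ?T y $$ (i div r k, ?a) * ?U y $$ (i mod r k, ?c))" if "i < s k * r k" for i
  proof -
    have "kronecker (?T y) (?U y) $$ (i, j) = ?T y $$ (i div r k, ?a) * ?U y $$ (i mod r k, ?c)"
      if "y < ?N" for y
    proof (rule kronecker_index)
      show "?T y \<in> carrier_mat (s k) (s (Suc k))" "?U y \<in> carrier_mat (r k) (r (Suc k))"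
        using T U k that by (force simp: tensor_train_def)+
    qed (use \<open>i < s k * r k\<close> j in auto)
    then show ?thesis
      using that j by (simp add: bracket_def)
  qed
  have "joint_sum n T U (Suc k) ?a ?c =
      (\<Sum>us\<in>?E. \<Sum>y<?N. \<Sum>i<s k. \<Sum>l<r k.
        ?t us $$ (0, i) * ?u us $$ (0, l) * (?T y $$ (i, ?a) * ?U y $$ (l, ?c)))"
  proof -
    have "{1..Suc k} = insert (Suc k) {1..k}"
      by auto
    then show ?thesis
      unfolding joint_sum_def by (simp add: sum_PiE_insert step del: tt_product.simps)
  qed
  \<comment> \<open>Two rounds of interchanges move the rank sums outside all mode sums.\<close>
  also have "\<dots> = (\<Sum>us\<in>?E. \<Sum>i<s k. \<Sum>l<r k. \<Sum>y<?N.
        ?t us $$ (0, i) * ?u us $$ (0, l) * (?T y $$ (i, ?a) * ?U y $$ (l, ?c)))"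
    by (simp add: sum.swap[of _ _ "{..<?N}"])
  also have "\<dots> = (\<Sum>i<s k. \<Sum>l<r k. \<Sum>us\<in>?E. \<Sum>y<?N.
        ?t us $$ (0, i) * ?u us $$ (0, l) * (?T y $$ (i, ?a) * ?U y $$ (l, ?c)))"
    by (subst sum.swap, rule sum.cong[OF refl], rule sum.swap)
  also have "\<dots> = (\<Sum>i<s k. \<Sum>l<r k. joint_sum n T U k i l *
        (\<Sum>y<?N. ?T y $$ (i, ?a) * ?U y $$ (l, ?c)))"
    by (simp add: joint_sum_def sum_product)
  also have "\<dots> = (\<Sum>i<s k * r k. joint_sum n T U k (i div r k) (i mod r k) *
        (\<Sum>y<?N. ?T y $$ (i div r k, ?a) * ?U y $$ (i mod r k, ?c)))"
    by (rule sum_div_mod[symmetric])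
  finally show ?thesis
    by (simp add: bracket_index)
qed

text \<open>The row vector stores the invariant in row-major order. The induction starts at
  \<open>k = 1\<close> because stage 1 returns the bracketed matrix itself, whereas later stages
  multiply by it.\<close>

lemma run_stages_eq_joint_sum:
  assumes T: "tensor_train p n s T" and U: "tensor_train p n r U"
    and S: "carries_out_steps p n s r S T U" and k: "1 \<le> k" "k \<le> p"
  shows "run_stages s r S T U k =
    mat 1 (s k * r k) (\<lambda>(_, j). joint_sum n T U k (j div r k) (j mod r k))"
  using k
proof (induction k rule: dec_induct)
  case base
  have s0: "s 0 = 1" "r 0 = 1"
    using T U by (auto simp: tensor_train_def)
  \<comment> \<open>The dummy start \<open>0\<^sub>m 1 1\<close> is an admissible incoming vector,
    since \<open>s 0 * r 0 = 1\<close>.\<close>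
  have "run_stages s r S T U 1 = bracket n s r T U 1"
    using S base s0 by (simp add: carries_out_steps_def)
  also have "\<dots> = mat 1 (s 1 * r 1) (\<lambda>(_, j). joint_sum n T U 1 (j div r 1) (j mod r 1))"
  proof (rule eq_matI)
    fix i j
    assume "i < dim_row (mat 1 (s 1 * r 1) (\<lambda>(_, j). joint_sum n T U 1 (j div r 1) (j mod r 1)))"
      "j < dim_col (mat 1 (s 1 * r 1) (\<lambda>(_, j). joint_sum n T U 1 (j div r 1) (j mod r 1)))"
    \<comment> \<open>At \<open>k = 0\<close> the sum in \<open>joint_sum_Suc\<close> has the single
      term \<open>i = 0\<close>, with weight \<open>joint_sum n T U 0 0 0 = 1\<close>.\<close>
    then show "bracket n s r T U 1 $$ (i, j) =
        mat 1 (s 1 * r 1) (\<lambda>(_, j). joint_sum n T U 1 (j div r 1) (j mod r 1)) $$ (i, j)"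
      using joint_sum_Suc[OF T U, of 0 j] base by (simp add: s0 joint_sum_0)
  qed (auto simp: bracket_def s0)
  finally show ?case .
next
  case (step k)
  let ?w = "run_stages s r S T U k"
  have w: "?w = mat 1 (s k * r k) (\<lambda>(_, j). joint_sum n T U k (j div r k) (j mod r k))"
    using step by simp
  then have "?w \<in> carrier_mat 1 (s k * r k)"
    by simp
  then have "run_stages s r S T U (Suc k) = ?w * bracket n s r T U (Suc k)"
    using S step by (auto simp: carries_out_steps_def Ball_def dest!: spec[of _ "Suc k"])
  also have "\<dots> = mat 1 (s (Suc k) * r (Suc k))
      (\<lambda>(_, j). joint_sum n T U (Suc k) (j div r (Suc k)) (j mod r (Suc k)))"
    (is "_ = ?R")
  proof (rule eq_matI)
    fix i j
    assume "i < dim_row ?R" "j < dim_col ?R"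
    moreover have "bracket n s r T U (Suc k) \<in> carrier_mat (s k * r k) (s (Suc k) * r (Suc k))"
      by (simp add: bracket_def)
    ultimately show "(?w * bracket n s r T U (Suc k)) $$ (i, j) = ?R $$ (i, j)"
      using joint_sum_Suc[OF T U, of k j] step.prems
      by (simp add: w scalar_prod_def atLeast0LessThan)
  qed (auto simp: w bracket_def)
  finally show ?case .
qed

text \<open>\<open>reshape\<close> undoes the row-major order: for \<open>v < r p\<close>, division
  of \<open>u * r p + v\<close> by \<open>r p\<close> gives back \<open>u\<close> and
  \<open>v\<close> as quotient and remainder.\<close>

lemma reshape_run_stages:
  assumes T: "tensor_train p n s T" and U: "tensor_train p n r U"
    and S: "carries_out_steps p n s r S T U" and p: "1 \<le> p"
  shows "reshape (s p) (r p) (run_stages s r S T U p) = contraction p n s r T U"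
proof -
  have "u * r p + v < s p * r p" if "u < s p" "v < r p" for u v
  proof -
    have "u * r p + v < Suc u * r p"
      using that by simp
    also have "\<dots> \<le> s p * r p"
      using that by (intro mult_le_mono1) simp
    finally show ?thesis .
  qed
  then show ?thesis
    unfolding run_stages_eq_joint_sum[OF T U S p order_refl]
    by (intro eq_matI) (auto simp: reshape_def contraction_def joint_sum_def tt_entry_def)
qed

section \<open>Sparsity of the structured cores\<close>

text \<open>One pattern covers all cores: first row, diagonal, second column, the subdiagonal of the
  last gradient core, and the single column of the last generator core.\<close>

definition core_support :: "nat \<Rightarrow> nat \<Rightarrow> (nat \<times> nat) set" where
  "core_support m q = {(a, c). a < m \<and> c < q \<and> (a = 0 \<or> a = c \<or> c = 1 \<or> a = Suc c \<or> q = 1)}"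

text \<open>One line of at most \<open>N\<close> positions for each of the five disjuncts of
  \<open>core_support\<close>, in the same order; if \<open>q = 1\<close>, the column index is
  0.\<close>

lemma core_support_subset:
  assumes "m \<le> N" "q \<le> N"
  shows "core_support m q \<subseteq> Pair 0 ` {..<N} \<union> (\<lambda>a. (a, a)) ` {..<N} \<union> (\<lambda>a. (a, 1)) ` {..<N}
    \<union> (\<lambda>c. (Suc c, c)) ` {..<N} \<union> (\<lambda>a. (a, 0)) ` {..<N}"
  using assms by (auto simp: core_support_def image_iff)

lemma finite_core_support: "finite (core_support m q)"
  by (rule finite_subset[of _ "{..<m} \<times> {..<q}"]) (auto simp: core_support_def)

lemma card_core_support_le:
  assumes "m \<le> N" "q \<le> N"
  shows "card (core_support m q) \<le> 5 * N"
proof -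
  have le: "card (f ` {..<N}) \<le> N" for f :: "nat \<Rightarrow> nat \<times> nat"
    using card_image_le[of "{..<N}" f] by simp
  have "card (core_support m q) \<le> card (Pair 0 ` {..<N} \<union> (\<lambda>a. (a, a)) ` {..<N}
      \<union> (\<lambda>a. (a, 1)) ` {..<N} \<union> (\<lambda>c. (Suc c, c)) ` {..<N} \<union> (\<lambda>a. (a, 0)) ` {..<N})"
    using core_support_subset[OF assms] by (intro card_mono) auto
  also have "\<dots> \<le> N + N + N + N + N"
    by (intro order_trans[OF card_Un_le] add_mono le)
  finally show ?thesis
    by simp
qed

text \<open>With \<open>p \<ge> 2\<close> the first core is never the last one, so the case order in
  the definitions of the trains agrees with \<open>structured_rank\<close>.\<close>

lemma structured_train_carrier:
  assumes "p \<ge> 2" "k \<in> {1..p}"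
  shows "structured_train kind d p \<psi> b \<sigma> x k u \<in>
    carrier_mat (structured_rank kind d p (k - 1)) (structured_rank kind d p k)"
  using assms by (cases kind) (auto simp: generator_train_def gradient_train_def Let_def)

text \<open>The zeros are written into the definitions of the cores, so they occur for all basis
  functions, coefficients and points. Hence the pattern can be fixed before the inputs.\<close>

lemma structured_train_zero:
  fixes kind d p
  defines "s \<equiv> structured_rank kind d p"
  assumes "p \<ge> 2" "k \<in> {1..p}" "a < s (k - 1)" "c < s k" "(a, c) \<notin> core_support (s (k - 1)) (s k)"
  shows "structured_train kind d p \<psi> b \<sigma> x k u $$ (a, c) = 0"
  using assms
  by (cases kind)
    (auto simp: generator_train_def gradient_train_def core_support_def Let_def split: if_splits)

lemma structured_rank_le: "structured_rank kind d p k \<le> d + 2"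
  by (cases kind) auto

section \<open>Cost and correctness of all steps together\<close>

theorem lemma4p1:
  "\<exists>C::real. \<forall>(kind::train_kind) (d::nat) (p::nat) (n::nat \<Rightarrow> nat) (r::nat \<Rightarrow> nat).
     d \<ge> 1 \<longrightarrow> p \<ge> 2 \<longrightarrow> r 0 = 1 \<longrightarrow> (\<forall>k\<in>{1..p}. r k \<ge> 1) \<longrightarrow>
     (\<exists>S. real (operation_count p S) \<le> C * real (\<Sum>k=1..p. n k * d * r (k - 1) * r k) \<and>
        (\<forall>X \<psi> b \<sigma> x U.
           X \<subseteq> topspace (Euclidean_space d) \<longrightarrow> x \<in> X \<longrightarrow>
           (\<forall>k\<in>{1..p}. \<forall>u<n k. C2_on d X (\<psi> k u)) \<longrightarrow>
           (\<forall>y\<in>X. b y \<in> carrier_vec d \<and> \<sigma> y \<in> carrier_mat d d) \<longrightarrow>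
           tensor_train p n r U \<longrightarrow>
           (let T = structured_train kind d p \<psi> b \<sigma> x; s = structured_rank kind d p in
              carries_out_steps p n s r S T U \<and>
              reshape (s p) (r p) (run_stages s r S T U p) = contraction p n s r T U)))"
proof (intro exI[of _ 60] allI impI, goal_cases)
  case (1 kind d p n r)
  define s where "s = structured_rank kind d p"
  \<comment> \<open>If \<open>n k = 0\<close> there are no slices, so the empty pattern is valid;
    \<open>sparse_stage\<close> demands it in this case.\<close>
  define Q where "Q = (\<lambda>k. if n k = 0 then {} else core_support (s (k - 1)) (s k))"
  \<comment> \<open>\<open>sparse_stage\<close> is used with \<open>k = 1\<close> for
    \<open>first\<close>. The stages depend on \<open>kind\<close>, \<open>d\<close>,
    \<open>p\<close>, \<open>n\<close> and \<open>r\<close> alone and are chosen before the basis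
    functions, the coefficients, the point and \<open>U\<close>.\<close>
  have "\<forall>k. \<exists>S. length (instructions S) \<le> 4 * n k * (card (Q k) * (r (k - 1) * r k)) \<and>
    (\<forall>A B w M.
      (\<forall>u<n k. A u \<in> carrier_mat (s (k - 1)) (s k) \<and> B u \<in> carrier_mat (r (k - 1)) (r k) \<and>
        (\<forall>a<s (k - 1). \<forall>c<s k. (a, c) \<notin> Q k \<longrightarrow> A u $$ (a, c) = 0)) \<longrightarrow>
      w \<in> carrier_mat 1 (s (k - 1) * r (k - 1)) \<longrightarrow>
      M = mat (s (k - 1) * r (k - 1)) (s k * r k)
        (\<lambda>(i, j). \<Sum>u<n k. kronecker (A u) (B u) $$ (i, j)) \<longrightarrow>
      stage_bracket (s (k - 1) * r (k - 1)) (s k * r k) S A B w = M \<and>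
      stage_result (s k * r k) S A B w =
        (if k = 1 \<and> s (k - 1) * r (k - 1) = 1 then M else w * M))"
    by (intro allI sparse_stage) (auto simp: Q_def finite_core_support)
  from choice[OF this] obtain S where
    len: "\<And>k. length (instructions (S k)) \<le> 4 * n k * (card (Q k) * (r (k - 1) * r k))"
    and S: "\<And>k A B w M.
      (\<forall>u<n k. A u \<in> carrier_mat (s (k - 1)) (s k) \<and> B u \<in> carrier_mat (r (k - 1)) (r k) \<and>
        (\<forall>a<s (k - 1). \<forall>c<s k. (a, c) \<notin> Q k \<longrightarrow> A u $$ (a, c) = 0)) \<Longrightarrow>
      w \<in> carrier_mat 1 (s (k - 1) * r (k - 1)) \<Longrightarrow>
      M = mat (s (k - 1) * r (k - 1)) (s k * r k)
        (\<lambda>(i, j). \<Sum>u<n k. kronecker (A u) (B u) $$ (i, j)) \<Longrightarrow>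
      stage_bracket (s (k - 1) * r (k - 1)) (s k * r k) (S k) A B w = M \<and>
      stage_result (s k * r k) (S k) A B w =
        (if k = 1 \<and> s (k - 1) * r (k - 1) = 1 then M else w * M)"
    by blast
  have cost: "length (instructions (S k)) \<le> 60 * (n k * d * r (k - 1) * r k)" for k
  proof -
    have "card (Q k) \<le> 5 * (d + 2)"
      using card_core_support_le[OF structured_rank_le structured_rank_le] by (simp add: Q_def s_def)
    \<comment> \<open>Here \<open>d \<ge> 1\<close> enters, as
      \<open>10 \<le> 10 * d\<close>.\<close>
    also have "\<dots> \<le> 15 * d"
      using 1 by simp
    finally have cardQ: "card (Q k) \<le> 15 * d" .
    have "length (instructions (S k)) \<le> 4 * n k * (card (Q k) * (r (k - 1) * r k))"
      by (rule len)
    also have "\<dots> \<le> 4 * n k * (15 * d * (r (k - 1) * r k))"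
      by (intro mult_le_mono order_refl cardQ)
    finally show ?thesis
      by (simp add: algebra_simps)
  qed
  have count: "real (operation_count p S) \<le> 60 * real (\<Sum>k=1..p. n k * d * r (k - 1) * r k)"
  proof -
    have "operation_count p S \<le> 60 * (\<Sum>k=1..p. n k * d * r (k - 1) * r k)"
      unfolding operation_count_def sum_distrib_left by (intro sum_mono cost)
    then have "real (operation_count p S) \<le> real (60 * (\<Sum>k=1..p. n k * d * r (k - 1) * r k))"
      by (rule of_nat_mono)
    then show ?thesis
      by simp
  qed
  have "carries_out_steps p n s r S T U \<and>
      reshape (s p) (r p) (run_stages s r S T U p) = contraction p n s r T U"
    if U: "tensor_train p n r U" and T: "T = structured_train kind d p \<psi> b \<sigma> x" for T U \<psi> b \<sigma> x
  proof -
    have s0: "s 0 = 1"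
      by (cases kind) (simp_all add: s_def)
    have carrier: "T k u \<in> carrier_mat (s (k - 1)) (s k)" if "k \<in> {1..p}" for k u
      unfolding T s_def using 1 that by (intro structured_train_carrier) auto
    have "carries_out_steps p n s r S T U"
      unfolding carries_out_steps_def
    proof (intro ballI)
      fix k and w :: "real mat"
      assume k: "k \<in> {1..p}" and w: "w \<in> carrier_mat 1 (s (k - 1) * r (k - 1))"
      have "T k u $$ (a, c) = 0"
        if "u < n k" "a < s (k - 1)" "c < s k" "(a, c) \<notin> Q k" for u a c
        unfolding T using 1 k that
        by (intro structured_train_zero) (auto simp: Q_def s_def split: if_splits)
      then have cores: "\<forall>u<n k. T k u \<in> carrier_mat (s (k - 1)) (s k) \<and>
          U k u \<in> carrier_mat (r (k - 1)) (r k) \<and>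
          (\<forall>a<s (k - 1). \<forall>c<s k. (a, c) \<notin> Q k \<longrightarrow> T k u $$ (a, c) = 0)"
        using carrier U k by (auto simp: tensor_train_def)
      have "stage_bracket (s (k - 1) * r (k - 1)) (s k * r k) (S k) (T k) (U k) w =
            bracket n s r T U k \<and>
          stage_result (s k * r k) (S k) (T k) (U k) w =
            (if k = 1 \<and> s (k - 1) * r (k - 1) = 1 then bracket n s r T U k
             else w * bracket n s r T U k)"
        by (rule S[OF cores w]) (simp add: bracket_def)
      \<comment> \<open>For \<open>k = 1\<close> the extra condition holds because
        \<open>s 0 * r 0 = 1\<close>.\<close>
      then show "stage_bracket (s (k - 1) * r (k - 1)) (s k * r k) (S k) (T k) (U k) w =
            bracket n s r T U k \<and>
          stage_result (s k * r k) (S k) (T k) (U k) w =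
            (if k = 1 then bracket n s r T U k else w * bracket n s r T U k)"
        using 1 s0 by (auto split: if_splits)
    qed
    moreover from this have "reshape (s p) (r p) (run_stages s r S T U p) = contraction p n s r T U"
      using s0 carrier 1 by (intro reshape_run_stages[OF _ U]) (auto simp: tensor_train_def)
    ultimately show ?thesis ..
  qed
  with count show ?case
    by (intro exI[of _ S]) (simp add: Let_def s_def)
qed

end
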